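(* Suppose that each $Q^{(i)}$ ($i\in\mathcal I$) is quasi-firmly nonexpansive, each $f^{(i)}$ ($i\in\mathcal I$) is continuous and convex, and $X^\star\neq\emptyset$. Let $(x_n)_{n\in\mathbb N}$ and $(x_n^{(i)})_{n\in\mathbb N}$ be generated by the incremental subgradient method with constant step size $\lambda_n:=\lambda\in(0,\infty)$ ($n\in\mathbb N$). Suppose that for every $i\in\mathcal I$ there are $N_1^{(i)},N_2^{(i)}\in\mathbb R$ such that $$\sup\{\|g\|: g\in\partial f^{(i)}(Q_\alpha^{(i)}(x_n^{(i-1)})),\ n\in\mathbb N\}\le N_1^{(i)},\qquad \sup\{\|g\|: g\in\partial f^{(i)}(x_n),\ n\in\mathbb N\}\le N_2^{(i)},$$ and put $N_1:=\max_{i\in\mathcal I}(N_1^{(i)})^2$ and $N_2:=\max_{i\in\mathcal I}N_2^{(i)}$. Fix some $x\in X$ and put $$N_\lambda:=\sup_{n\in\mathbb N}\Big(I N_1\lambda+\Big|\sum_{i\in\mathcal I}\langle x-x_n^{(i-1)},g_n^{(i)}\rangle\Big|\Big)\in[0,\infty].$$ Then $$\liminf_{n\to\infty}\|x_n^{(i-1)}-Q^{(i)}(x_n^{(i-1)})\|^2\le\frac{N_\lambda\lambda}{\alpha^{(i)}(1-\alpha^{(i)})}\qquad(i\in\mathcal I),$$ $$\liminf_{n\to\infty}f(x_n)\le f^\star+I\Big(\frac{I\sqrt{N_1}N_2}{2}+N_1\Big)\lambda+N_2\sum_{i\in\mathcal I}\sum_{j=1}^{i-1}\sqrt{\frac{(1-\alpha^{(j)})N_\lambda\lambda}{\alpha^{(j)}}}+\big(\sqrt{N_1}+N_2\big)\sum_{i\in\mathcal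 I}\sqrt{\frac{(1-\alpha^{(i)})N_\lambda\lambda}{\alpha^{(i)}}}.$$
   Context: $H$ is a real Hilbert space with inner product $\langle\cdot,\cdot\rangle$ and norm $\|\cdot\|$; $\mathrm{Id}$ is the identity on $H$; $\mathbb N=\{0,1,2,\dots\}$. For $Q:H\to H$, $\mathrm{Fix}(Q)=\{x\in H: Q(x)=x\}$. $Q$ is quasi-firmly nonexpansive if $\|Q(x)-y\|^2+\|(\mathrm{Id}-Q)(x)\|^2\le\|x-y\|^2$ for all $x\in H$, $y\in\mathrm{Fix}(Q)$. The subdifferential of $f:H\to\mathbb R$ at $x$ is $\partial f(x)=\{u\in H: f(y)\ge f(x)+\langle y-x,u\rangle\ \forall y\in H\}$. Setting: $I\ge1$ is an integer (number of users), $\mathcal I=\{1,\dots,I\}$; for $i\in\mathcal I$, $f^{(i)}:H\to\mathbb R$, $Q^{(i)}:H\to H$, $\alpha^{(i)}\in(0,1)$, $Q_\alpha^{(i)}:=\alpha^{(i)}\mathrm{Id}+(1-\alpha^{(i)})Q^{(i)}$. Put $X:=\bigcap_{i\in\mathcal I}\mathrm{Fix}(Q^{(i)})$, $f:=\sum_{i\in\mathcal I}f^{(i)}$, $f^\star:=\inf_{y\in X}f(y)$, $X^\star:=\{x\in X: f(x)=f^\star\}$. (Operationally, user $i$ can use $Q^{(i)}$ and $\partial f^{(i)}$, and each user can communicate with its neighbors in a ring, so that the method can be run.) Incremental subgradient method: given $x_0=x_0^{(0)}\in H$ and $(\lambda_n)_{n\in\mathbb N}\subset(0,\infty)$, for every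 $n\in\mathbb N$, successively for $i=1,\dots,I$, $$x_n^{(i)}:=Q_\alpha^{(i)}(x_n^{(i-1)})-\lambda_n g_n^{(i)},\quad g_n^{(i)}\in\partial f^{(i)}(Q_\alpha^{(i)}(x_n^{(i-1)})),$$ and then $x_{n+1}=x_{n+1}^{(0)}:=x_n^{(I)}$. Thus $x_n^{(0)}=x_n$ for all $n$. Empty sums are $0$. If $N_\lambda=\infty$, the right-hand sides of the bounds are understood as $+\infty$ . *)

theory Defs
  imports "HOL-Analysis.Analysis"
begin

definition Fix :: "('a \<Rightarrow> 'a) \<Rightarrow> 'a set" where
  "Fix Q = {x. Q x = x}"

definition quasi_firmly_nonexpansive :: "('a::real_inner \<Rightarrow> 'a) \<Rightarrow> bool" where
  "quasi_firmly_nonexpansive Q \<longleftrightarrow>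
     (\<forall>x. \<forall>y \<in> Fix Q. (norm (Q x - y))\<^sup>2 + (norm (x - Q x))\<^sup>2 \<le> (norm (x - y))\<^sup>2)"

definition subdifferential :: "('a::real_inner \<Rightarrow> real) \<Rightarrow> 'a \<Rightarrow> 'a set" where
  "subdifferential f x = {u. \<forall>y. f y \<ge> f x + inner (y - x) u}"

definition relaxation :: "real \<Rightarrow> ('a::real_vector \<Rightarrow> 'a) \<Rightarrow> 'a \<Rightarrow> 'a" where
  "relaxation \<alpha> Q x = \<alpha> *\<^sub>R x + (1 - \<alpha>) *\<^sub>R Q x"

text \<open>The users are \<open>1, \<dots>, I\<close>; families indexed by users are functions on \<open>nat\<close>
  whose values outside \<open>{1..I}\<close> are irrelevant.\<close>

definition common_fix :: "nat \<Rightarrow> (nat \<Rightarrow> 'a \<Rightarrow> 'a) \<Rightarrow> 'a set" where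
  "common_fix I Q = (\<Inter>i\<in>{1..I}. Fix (Q i))"

definition total_objective :: "nat \<Rightarrow> (nat \<Rightarrow> 'a \<Rightarrow> real) \<Rightarrow> 'a \<Rightarrow> real" where
  "total_objective I f x = (\<Sum>i\<in>{1..I}. f i x)"

text \<open>The infimum is taken in the extended reals, since \<open>Inf\<close> on \<open>real\<close> is unspecified on
  sets that are empty or unbounded below.\<close>

definition optimal_value :: "nat \<Rightarrow> (nat \<Rightarrow> 'a \<Rightarrow> real) \<Rightarrow> (nat \<Rightarrow> 'a \<Rightarrow> 'a) \<Rightarrow> ereal" where
  "optimal_value I f Q = (INF y\<in>common_fix I Q. ereal (total_objective I f y))"

definition solution_set :: "nat \<Rightarrow> (nat \<Rightarrow> 'a \<Rightarrow> real) \<Rightarrow> (nat \<Rightarrow> 'a \<Rightarrow> 'a) \<Rightarrow> 'a set" where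
  "solution_set I f Q =
     {x \<in> common_fix I Q. ereal (total_objective I f x) = optimal_value I f Q}"

text \<open>\<open>xs n i\<close> is the \<open>i\<close>-th inner iterate (\<open>0 \<le> i \<le> I\<close>) and \<open>g n i\<close> the subgradient chosen by
  user \<open>i\<close> in round \<open>n\<close>. The starting point and the selection of subgradients are arbitrary, so
  the method is a predicate on the generated sequences.\<close>

definition incremental_subgradient ::
  "nat \<Rightarrow> (nat \<Rightarrow> 'a::real_inner \<Rightarrow> real) \<Rightarrow> (nat \<Rightarrow> 'a \<Rightarrow> 'a) \<Rightarrow> (nat \<Rightarrow> real) \<Rightarrow> (nat \<Rightarrow> real) \<Rightarrow>
   (nat \<Rightarrow> 'a) \<Rightarrow> (nat \<Rightarrow> nat \<Rightarrow> 'a) \<Rightarrow> (nat \<Rightarrow> nat \<Rightarrow> 'a) \<Rightarrow> bool" where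
  "incremental_subgradient I f Q \<alpha> step x xs g \<longleftrightarrow>
     (\<forall>n. xs n 0 = x n) \<and>
     (\<forall>n. \<forall>i\<in>{1..I}.
        g n i \<in> subdifferential (f i) (relaxation (\<alpha> i) (Q i) (xs n (i - 1))) \<and>
        xs n i = relaxation (\<alpha> i) (Q i) (xs n (i - 1)) - step n *\<^sub>R g n i) \<and>
     (\<forall>n. x (Suc n) = xs n I)"

end

theory Submission
  imports Defs
begin

text \<open>
  Let \<open>y\<close> be a common fixed point. One round of the method changes \<open>(norm (x n - y))\<^sup>2\<close> by an
  amount that can be estimated in two ways.

  \<^item> Quasi-firm nonexpansiveness makes the distance decrease by a multiple of the squared
    displacement \<open>(norm (xs n (i - 1) - Q i (xs n (i - 1))))\<^sup>2\<close> of every user, up to an error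
    controlled by \<open>Nlam\<close> when \<open>y = xhat\<close> (\<open>round_displacement\<close>).
  \<^item> The subgradient inequality makes it decrease by a multiple of
    \<open>total_objective I f (x n) - total_objective I f y\<close>, up to an error linear in the
    displacements: the subgradient of user \<open>i\<close> is taken not at \<open>x n\<close> but at a point to which the
    preceding users have drifted (\<open>round_objective\<close>).

  Both estimates telescope, so neither displacements nor objective values can stay above the
  claimed bounds. The difficulty is that the displacements of different users need not be small
  in the same rounds, so bounds on their individual limits inferior cannot be inserted into the
  objective estimate. Time averages avoid this: the first estimate bounds the average of each
  squared displacement, hence by convexity of the square the average of each displacement;
  averages add up, so the second estimate bounds the average of the objective values; and a limit
  inferior never exceeds an asymptotic bound on averages. The relation \<open>mean_le\<close> below expresses
  such a bound.

  The objective estimate compares \<open>f i\<close> at \<open>x n\<close> and at the drifted point through a subgradient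
  at \<open>x n\<close>, which must exist. For a continuous convex function on a Hilbert space this follows by
  projecting onto the closed epigraph, which yields \<open>\<epsilon>\<close>-subgradients, and letting \<open>\<epsilon>\<close> tend to
  zero (\<open>subdifferential_nonempty\<close>).
\<close>

section \<open>Upper bounds in the mean\<close>

text \<open>Equivalently, the limit superior of the averages \<open>(\<Sum>n<N. a n) / N\<close> is at most \<open>c\<close>. With
  partial sums and an additive constant \<open>K\<close>, telescoping sums need no division and no limits.\<close>

definition mean_le :: "(nat \<Rightarrow> real) \<Rightarrow> real \<Rightarrow> bool" where
  "mean_le a c \<longleftrightarrow> (\<forall>\<epsilon>>0. \<exists>K. \<forall>N. (\<Sum>n<N. a n) \<le> real N * (c + \<epsilon>) + K)"

lemma mean_leI:
  assumes "\<And>\<epsilon>. \<epsilon> > 0 \<Longrightarrow> \<exists>K. \<forall>N. (\<Sum>n<N. a n) \<le> real N * (c + \<epsilon>) + K"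
  shows "mean_le a c"
  using assms by (simp add: mean_le_def)

lemma mean_leE:
  assumes "mean_le a c" and "\<epsilon> > 0"
  obtains K where "\<And>N. (\<Sum>n<N. a n) \<le> real N * (c + \<epsilon>) + K"
  using assms unfolding mean_le_def by blast

lemma mean_le_mono:
  assumes "mean_le a c" and "\<And>n. b n \<le> a n" and "c \<le> d"
  shows "mean_le b d"
proof (rule mean_leI)
  fix \<epsilon> :: real assume "\<epsilon> > 0"
  then obtain K where K: "\<And>N. (\<Sum>n<N. a n) \<le> real N * (c + \<epsilon>) + K"
    using mean_leE[OF assms(1)] by blast
  have "(\<Sum>n<N. b n) \<le> real N * (d + \<epsilon>) + K" for N
  proof -
    have "(\<Sum>n<N. b n) \<le> (\<Sum>n<N. a n)"
      using assms(2) by (simp add: sum_mono)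
    moreover have "real N * (c + \<epsilon>) \<le> real N * (d + \<epsilon>)"
      using assms(3) by (simp add: mult_left_mono)
    ultimately show ?thesis using K[of N] by linarith
  qed
  then show "\<exists>K. \<forall>N. (\<Sum>n<N. b n) \<le> real N * (d + \<epsilon>) + K" by blast
qed

lemma mean_le_const: "mean_le (\<lambda>_. c) c"
  by (rule mean_leI, rule exI[of _ 0]) (simp add: mult_left_mono)

lemma mean_le_add:
  assumes "mean_le a c" and "mean_le b d"
  shows "mean_le (\<lambda>n. a n + b n) (c + d)"
proof (rule mean_leI)
  fix \<epsilon> :: real assume "\<epsilon> > 0"
  then have "\<epsilon> / 2 > 0" by simp
  then obtain K L where K: "\<And>N. (\<Sum>n<N. a n) \<le> real N * (c + \<epsilon> / 2) + K"
    and L: "\<And>N. (\<Sum>n<N. b n) \<le> real N * (d + \<epsilon> / 2) + L"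
    using mean_leE[OF assms(1)] mean_leE[OF assms(2)] by metis
  have "(\<Sum>n<N. a n + b n) \<le> real N * (c + d + \<epsilon>) + (K + L)" for N
    using K[of N] L[of N] by (simp add: sum.distrib algebra_simps)
  then show "\<exists>K. \<forall>N. (\<Sum>n<N. a n + b n) \<le> real N * (c + d + \<epsilon>) + K" by blast
qed

lemma mean_le_sum:
  assumes "finite S" and "\<And>i. i \<in> S \<Longrightarrow> mean_le (a i) (c i)"
  shows "mean_le (\<lambda>n. \<Sum>i\<in>S. a i n) (\<Sum>i\<in>S. c i)"
  using assms
proof (induction S rule: finite_induct)
  case empty
  show ?case using mean_le_const[of 0] by simp
next
  case (insert i S)
  then show ?case by (simp add: mean_le_add)
qed

lemma mean_le_cmult:
  assumes "mean_le a c" and "k \<ge> 0"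
  shows "mean_le (\<lambda>n. k * a n) (k * c)"
proof (rule mean_leI)
  fix \<epsilon> :: real assume \<epsilon>: "\<epsilon> > 0"
  define \<delta> where "\<delta> = \<epsilon> / (k + 1)"
  have \<delta>: "\<delta> > 0" "k * \<delta> \<le> \<epsilon>"
    using \<epsilon> assms(2) by (auto simp: \<delta>_def field_simps)
  obtain K where K: "\<And>N. (\<Sum>n<N. a n) \<le> real N * (c + \<delta>) + K"
    using mean_leE[OF assms(1) \<delta>(1)] by blast
  have "(\<Sum>n<N. k * a n) \<le> real N * (k * c + \<epsilon>) + k * K" for N
  proof -
    have "(\<Sum>n<N. k * a n) \<le> k * (real N * (c + \<delta>) + K)"
      using mult_left_mono[OF K[of N] assms(2)] by (simp add: sum_distrib_left)
    also have "\<dots> = real N * (k * c + k * \<delta>) + k * K"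
      by (simp add: algebra_simps)
    also have "\<dots> \<le> real N * (k * c + \<epsilon>) + k * K"
      using \<delta>(2) by (simp add: mult_left_mono)
    finally show ?thesis .
  qed
  then show "\<exists>K. \<forall>N. (\<Sum>n<N. k * a n) \<le> real N * (k * c + \<epsilon>) + K" by blast
qed

lemma mean_le_telescope:
  assumes "\<And>n. 0 \<le> r n"
  shows "mean_le (\<lambda>n. r n - r (Suc n)) 0"
proof (rule mean_leI)
  fix \<epsilon> :: real assume "\<epsilon> > 0"
  have "(\<Sum>n<N. r n - r (Suc n)) \<le> real N * (0 + \<epsilon>) + r 0" for N
    using \<open>\<epsilon> > 0\<close> assms[of N] by (simp add: sum_lessThan_telescope' add_increasing)
  then show "\<exists>K. \<forall>N. (\<Sum>n<N. r n - r (Suc n)) \<le> real N * (0 + \<epsilon>) + K" by blast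
qed

text \<open>The square of an average is at most the average of the squares. The linear form
  \<open>2 * t * w \<le> t\<^sup>2 + w\<^sup>2\<close> of this, with \<open>t\<close> slightly above \<open>s\<close>, passes directly to partial sums;
  the shift keeps \<open>t\<close> positive when \<open>s = 0\<close>.\<close>

lemma mean_le_of_square:
  assumes "mean_le (\<lambda>n. (w n)\<^sup>2) (s\<^sup>2)" and "s \<ge> 0"
  shows "mean_le w s"
proof (rule mean_leI)
  fix \<epsilon> :: real assume \<epsilon>: "\<epsilon> > 0"
  define t where "t = s + \<epsilon>"
  have t: "t > 0" using assms(2) \<epsilon> by (simp add: t_def)
  have "s\<^sup>2 + \<epsilon>\<^sup>2 \<le> t\<^sup>2"
    using assms(2) \<epsilon> by (simp add: t_def power2_sum)
  moreover obtain K where K: "\<And>N. (\<Sum>n<N. (w n)\<^sup>2) \<le> real N * (s\<^sup>2 + \<epsilon>\<^sup>2) + K"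
    using mean_leE[OF assms(1), of "\<epsilon>\<^sup>2"] \<epsilon> by auto
  ultimately have K': "(\<Sum>n<N. (w n)\<^sup>2) \<le> real N * t\<^sup>2 + K" for N
    by (meson K add_right_mono mult_left_mono of_nat_0_le_iff order_trans)
  have "(\<Sum>n<N. w n) \<le> real N * (s + \<epsilon>) + K / (2 * t)" for N
  proof -
    have "w n \<le> (t\<^sup>2 + (w n)\<^sup>2) / (2 * t)" for n
      using t sum_squares_bound[of t "w n"] by (simp add: field_simps)
    then have "(\<Sum>n<N. w n) \<le> (\<Sum>n<N. (t\<^sup>2 + (w n)\<^sup>2) / (2 * t))"
      by (simp add: sum_mono)
    also have "\<dots> = (real N * t\<^sup>2 + (\<Sum>n<N. (w n)\<^sup>2)) / (2 * t)"
      by (simp add: sum_divide_distrib[symmetric] sum.distrib)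
    also have "\<dots> \<le> (real N * t\<^sup>2 + (real N * t\<^sup>2 + K)) / (2 * t)"
      using t K'[of N] by (intro divide_right_mono) auto
    also have "\<dots> = real N * (s + \<epsilon>) + K / (2 * t)"
      unfolding t_def[symmetric] using t by (simp add: field_simps power2_eq_square)
    finally show ?thesis .
  qed
  then show "\<exists>K. \<forall>N. (\<Sum>n<N. w n) \<le> real N * (s + \<epsilon>) + K" by blast
qed

text \<open>If \<open>a\<close> eventually stayed above some \<open>d > c\<close>, its partial sums would grow at least with
  slope \<open>d\<close>, against a permitted slope of any value above \<open>c\<close>.\<close>

lemma liminf_le_of_mean_le:
  assumes "mean_le a c"
  shows "liminf (\<lambda>n. ereal (a n)) \<le> ereal c"
proof (rule ccontr)
  assume "\<not> ?thesis"
  then have "ereal c < liminf (\<lambda>n. ereal (a n))" by simp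
  then obtain b where b: "ereal c < b" "b < liminf (\<lambda>n. ereal (a n))"
    using dense by blast
  then obtain d where d: "b = ereal d" by (cases b) auto
  have "eventually (\<lambda>n. b < ereal (a n)) sequentially"
    using b(2) less_LiminfD by blast
  then obtain M where M: "\<And>n. n \<ge> M \<Longrightarrow> d < a n"
    by (auto simp: d eventually_sequentially)
  define \<epsilon> where "\<epsilon> = (d - c) / 2"
  have \<epsilon>: "\<epsilon> > 0" "c + \<epsilon> = d - \<epsilon>" using b d by (auto simp: \<epsilon>_def field_simps)
  obtain K where K: "\<And>N. (\<Sum>n<N. a n) \<le> real N * (c + \<epsilon>) + K"
    using mean_leE[OF assms \<epsilon>(1)] by blast
  define A where "A = (\<Sum>n<M. a n)"
  have "A + real m * d \<le> real (M + m) * (c + \<epsilon>) + K" for m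
  proof -
    have "A + real m * d \<le> (\<Sum>n<M + m. a n)"
    proof (induction m)
      case (Suc m)
      then show ?case using M[of "M + m"] by (simp add: algebra_simps)
    qed (simp add: A_def)
    then show ?thesis using K[of "M + m"] by linarith
  qed
  then have "real m * \<epsilon> \<le> real M * (c + \<epsilon>) + K - A" for m
    unfolding \<epsilon>(2) by (simp add: algebra_simps) (metis add.commute)
  moreover obtain m where "real m * \<epsilon> > real M * (c + \<epsilon>) + K - A"
    using reals_Archimedean3[OF \<epsilon>(1)] by blast
  ultimately show False using not_less by blast
qed

section \<open>Subgradients of continuous convex functions on a Hilbert space\<close>

text \<open>Bounded closed convex sets of a Hilbert space are weakly compact; this sequential consequence
  has an elementary proof. Pick \<open>v n \<in> C n\<close> of nearly minimal norm. The minimal norms increase to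
  a limit, and midpoints remain in the convex sets, so the parallelogram law forces \<open>v\<close> to be
  a Cauchy sequence.\<close>

lemma closed_convex_nested_nonempty:
  fixes C :: "nat \<Rightarrow> 'a::{real_inner, complete_space} set"
  assumes dec: "decseq C" and closed: "\<And>n. closed (C n)" and convex: "\<And>n. convex (C n)"
    and nonempty: "\<And>n. C n \<noteq> {}" and bounded: "bounded (C 0)"
  shows "(\<Inter>n. C n) \<noteq> {}"
proof -
  define r where "r n = Inf (norm ` C n)" for n
  have bdd: "bdd_below (norm ` C n)" for n
    by (rule bdd_belowI[of _ 0]) auto
  have r_le: "r n \<le> norm v" if "v \<in> C n" for v n
    unfolding r_def using that bdd by (auto intro: cInf_lower)
  have r_nonneg: "0 \<le> r n" for n
    unfolding r_def using nonempty by (auto intro!: cInf_greatest)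
  obtain B where B: "\<And>v. v \<in> C 0 \<Longrightarrow> norm v \<le> B"
    using bounded by (auto simp: bounded_iff)
  have r_bound: "r n \<le> B" for n
  proof -
    obtain v where "v \<in> C n" using nonempty by blast
    moreover have "C n \<subseteq> C 0" using dec by (simp add: decseqD)
    ultimately show ?thesis using r_le B by (meson order_trans subsetD)
  qed
  have r_mono: "r m \<le> r n" if "m \<le> n" for m n
    unfolding r_def using that dec nonempty bdd
    by (intro cInf_superset_mono image_mono) (auto simp: decseqD)
  have "\<exists>v\<in>C n. norm v < r n + 1 / real (Suc n)" for n
    using cInf_lessD[of "norm ` C n" "r n + 1 / real (Suc n)"] nonempty
    by (auto simp: r_def)
  then obtain v where v: "\<And>n. v n \<in> C n" "\<And>n. norm (v n) < r n + 1 / real (Suc n)"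
    by metis
  have "incseq r" using r_mono by (simp add: incseq_def)
  then obtain L where L: "r \<longlonglongrightarrow> L" "\<And>n. r n \<le> L"
    using incseq_convergent[of r B] r_bound by auto
  have "Cauchy v"
  proof (rule metric_CauchyI)
    fix e :: real assume e: "e > 0"
    have "(\<lambda>n. 4 * ((L + 1 / real (Suc n))\<^sup>2 - (r n)\<^sup>2)) \<longlonglongrightarrow> 4 * ((L + 0)\<^sup>2 - L\<^sup>2)"
      by (intro tendsto_intros L LIMSEQ_Suc[OF lim_1_over_n])
    then have "eventually (\<lambda>n. 4 * ((L + 1 / real (Suc n))\<^sup>2 - (r n)\<^sup>2) < e\<^sup>2) sequentially"
      by (rule order_tendstoD(2)) (use e in simp)
    then obtain M where M: "4 * ((L + 1 / real (Suc M))\<^sup>2 - (r M)\<^sup>2) < e\<^sup>2"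
      by (auto simp: eventually_sequentially)
    have "dist (v m) (v n) < e" if "m \<ge> M" "n \<ge> M" for m n
    proof -
      have small: "norm (v k) \<le> L + 1 / real (Suc M)" if "k \<ge> M" for k
      proof -
        have "1 / real (Suc k) \<le> 1 / real (Suc M)" using that by (simp add: frac_le)
        then show ?thesis using v(2)[of k] L(2)[of k] by linarith
      qed
      have "v m \<in> C M" "v n \<in> C M" using that v(1) decseqD[OF dec] by blast+
      then have "(1/2) *\<^sub>R v m + (1/2) *\<^sub>R v n \<in> C M"
        using convexD[OF convex] by simp
      then have "r M \<le> norm ((1/2) *\<^sub>R (v m + v n))" using r_le by (simp add: scaleR_add_right)
      then have "2 * r M \<le> norm (v m + v n)" by simp
      then have "(2 * r M)\<^sup>2 \<le> (norm (v m + v n))\<^sup>2"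
        using r_nonneg[of M] by (intro power_mono) auto
      \<comment> \<open>the parallelogram law\<close>
      moreover have "(norm (v m - v n))\<^sup>2 + (norm (v m + v n))\<^sup>2
          = 2 * (norm (v m))\<^sup>2 + 2 * (norm (v n))\<^sup>2"
        by (simp add: power2_norm_eq_inner algebra_simps inner_commute)
      moreover have "(norm (v m))\<^sup>2 \<le> (L + 1 / real (Suc M))\<^sup>2"
        "(norm (v n))\<^sup>2 \<le> (L + 1 / real (Suc M))\<^sup>2"
        using small that by (intro power_mono; simp)+
      moreover have "(2 * r M)\<^sup>2 = 4 * (r M)\<^sup>2" by (simp add: power_mult_distrib)
      ultimately have "(norm (v m - v n))\<^sup>2 \<le> 4 * ((L + 1 / real (Suc M))\<^sup>2 - (r M)\<^sup>2)"
        by (simp only: right_diff_distrib)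
      then have "(norm (v m - v n))\<^sup>2 < e\<^sup>2" using M by linarith
      then show ?thesis using e by (simp add: dist_norm power2_less_imp_less)
    qed
    then show "\<exists>M. \<forall>m\<ge>M. \<forall>n\<ge>M. dist (v m) (v n) < e" by blast
  qed
  then obtain w where w: "v \<longlonglongrightarrow> w"
    using Cauchy_convergent_iff convergent_def by blast
  have "w \<in> C n" for n
  proof (rule closed_sequentially[OF closed])
    show "(\<lambda>k. v (k + n)) \<longlonglongrightarrow> w" using w by (rule LIMSEQ_ignore_initial_segment)
    show "v (k + n) \<in> C n" for k using v(1)[of "k + n"] decseqD[OF dec, of n "k + n"] by auto
  qed
  then show ?thesis by blast
qed

text \<open>The points of \<open>S\<close> whose distance to \<open>a\<close> exceeds the infimum by at most
  \<open>1 / real (Suc n)\<close> form nested sets as in the previous lemma.\<close>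

lemma closed_convex_has_closest_point:
  fixes S :: "'a::{real_inner, complete_space} set"
  assumes "closed S" and "convex S" and "S \<noteq> {}"
  obtains q where "q \<in> S" and "\<And>z. z \<in> S \<Longrightarrow> dist a q \<le> dist a z"
proof -
  define C where "C n = S \<inter> cball a (infdist a S + 1 / real (Suc n))" for n
  have "(\<Inter>n. C n) \<noteq> {}"
  proof (rule closed_convex_nested_nonempty)
    show "decseq C"
    proof (rule decseq_SucI)
      fix n
      have "1 / real (Suc (Suc n)) \<le> 1 / real (Suc n)" by (simp add: frac_le)
      then show "C (Suc n) \<subseteq> C n" unfolding C_def by (intro Int_mono subset_cball) auto
    qed
    show "C n \<noteq> {}" for n
    proof -
      have "\<exists>z\<in>S. dist a z < infdist a S + 1 / real (Suc n)"
        using assms(3) cInf_lessD[of "dist a ` S" "infdist a S + 1 / real (Suc n)"]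
        by (auto simp: infdist_notempty)
      then show ?thesis by (force simp: C_def)
    qed
  qed (use assms in \<open>auto simp: C_def convex_Int closed_Int\<close>)
  then obtain q where q: "\<And>n. q \<in> C n" by blast
  have "(\<lambda>n. infdist a S + 1 / real (Suc n)) \<longlonglongrightarrow> infdist a S + 0"
    by (intro tendsto_intros LIMSEQ_Suc[OF lim_1_over_n])
  then have "dist a q \<le> infdist a S + 0"
    by (rule LIMSEQ_le_const) (use q in \<open>auto simp: C_def\<close>)
  moreover have "infdist a S \<le> dist a z" if "z \<in> S" for z
    using that by (rule infdist_le)
  ultimately have "dist a q \<le> dist a z" if "z \<in> S" for z
    using that by (metis add.right_neutral order_trans)
  then show ?thesis using that q[of 0] by (auto simp: C_def)
qed

text \<open>Project the point \<open>(x, f x - \<epsilon>)\<close>, which lies strictly below the graph, onto the closed convex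
  epigraph. The vector from the projection back to the point is normal to the epigraph and not
  horizontal; scaled to have last component \<open>-1\<close>, its first component is an \<open>\<epsilon>\<close>-subgradient.\<close>

lemma approximate_subgradient_exists:
  fixes f :: "'a::{real_inner, complete_space} \<Rightarrow> real"
  assumes cont: "continuous_on UNIV f" and conv: "convex_on UNIV f" and "\<epsilon> > 0"
  shows "\<exists>v. \<forall>y. f x - \<epsilon> + inner (y - x) v \<le> f y"
proof -
  let ?E = "epigraph UNIV f" and ?p = "(x, f x - \<epsilon>)"
  have E: "?E = {z. f (fst z) \<le> snd z}" by (auto simp: epigraph_def)
  have "closed ?E" unfolding E
    by (intro closed_Collect_le continuous_on_snd continuous_on_id
        continuous_on_compose2[OF cont] continuous_on_fst) auto
  moreover have convE: "convex ?E" using conv by (rule convex_epigraphI)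
  moreover have "?E \<noteq> {}" by (auto simp: E)
  ultimately obtain q where q: "q \<in> ?E" "\<And>z. z \<in> ?E \<Longrightarrow> dist ?p q \<le> dist ?p z"
    using closed_convex_has_closest_point by metis
  obtain a t where at: "q = (a, t)" by (cases q)
  have normal: "inner (x - a) (y - a) + (f x - \<epsilon> - t) * (s - t) \<le> 0" if "f y \<le> s" for y s
  proof -
    have "inner (?p - q) ((y, s) - q) \<le> 0"
      using any_closest_point_dot[OF convE \<open>closed ?E\<close> q(1) _ ] q that by (auto simp: E)
    then show ?thesis by (simp add: at inner_Pair)
  qed
  \<comment> \<open>\<open>- \<beta>\<close> is the last component of the normal vector.\<close>
  define \<beta> where "\<beta> = t - (f x - \<epsilon>)"
  have fa: "f a \<le> t" using q(1) by (simp add: at E)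
  have "\<beta> \<ge> 0" using normal[of a "t + 1"] fa by (simp add: \<beta>_def)
  moreover have "\<beta> \<noteq> 0"
  proof
    assume "\<beta> = 0"
    then have "inner (x - a) (x - a) \<le> 0" using normal[of x "f x"] by (simp add: \<beta>_def)
    then have "x = a" by (metis inner_eq_zero_iff inner_ge_zero order_antisym right_minus_eq)
    then show False using fa \<open>\<beta> = 0\<close> \<open>\<epsilon> > 0\<close> by (simp add: \<beta>_def)
  qed
  ultimately have \<beta>: "\<beta> > 0" by simp
  define v where "v = (1 / \<beta>) *\<^sub>R (x - a)"
  have "f x - \<epsilon> + inner (y - x) v \<le> f y" for y
  proof -
    have "inner (y - a) (x - a) \<le> \<beta> * (f y - t)"
      using normal[of y "f y"] by (simp add: \<beta>_def inner_commute algebra_simps)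
    moreover have "inner (y - a) v = inner (y - a) (x - a) / \<beta>" by (simp add: v_def)
    ultimately have "inner (y - a) v \<le> f y - t"
      using \<beta> by (simp add: pos_divide_le_eq mult.commute)
    moreover have "inner (y - a) v = inner (y - x) v + inner (x - a) v"
      by (simp add: inner_diff_left)
    moreover have "inner (x - a) v \<ge> 0" using \<beta> by (simp add: v_def)
    ultimately show ?thesis using \<beta> by (simp add: \<beta>_def)
  qed
  then show ?thesis by blast
qed

text \<open>The sets of \<open>\<epsilon>\<close>-subgradients at \<open>x\<close> are closed, convex and nested, and their intersection
  is the subdifferential. They are bounded because \<open>f\<close> is bounded above near \<open>x\<close>, so that no
  minorant that is almost exact at \<open>x\<close> can be too steep.\<close>

lemma subdifferential_nonempty:
  fixes f :: "'a::{real_inner, complete_space} \<Rightarrow> real"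
  assumes cont: "continuous_on UNIV f" and conv: "convex_on UNIV f"
  shows "subdifferential f x \<noteq> {}"
proof -
  define C where "C n = {v. \<forall>y. f x - 1 / real (Suc n) + inner (y - x) v \<le> f y}" for n
  have C: "C n = (\<Inter>y. {v. inner (y - x) v \<le> f y - f x + 1 / real (Suc n)})" for n
    by (auto simp: C_def algebra_simps)
  have "(\<Inter>n. C n) \<noteq> {}"
  proof (rule closed_convex_nested_nonempty)
    show "decseq C"
    proof (rule decseq_SucI, rule subsetI)
      fix n v assume v: "v \<in> C (Suc n)"
      have "1 / real (Suc (Suc n)) \<le> 1 / real (Suc n)" by (simp add: frac_le)
      moreover have "f x - 1 / real (Suc (Suc n)) + inner (y - x) v \<le> f y" for y
        using v by (simp add: C_def)
      ultimately have "f x - 1 / real (Suc n) + inner (y - x) v \<le> f y" for y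
        by (meson add_right_mono diff_left_mono order_trans)
      then show "v \<in> C n" unfolding C_def by blast
    qed
    show "closed (C n)" for n unfolding C by (intro closed_INT ballI closed_halfspace_le)
    show "convex (C n)" for n unfolding C by (intro convex_INT convex_halfspace_le)
    show "C n \<noteq> {}" for n
      using approximate_subgradient_exists[OF cont conv, of "1 / real (Suc n)" x]
      by (auto simp: C_def)
    show "bounded (C 0)"
    proof -
      have "isCont f x" using cont by (simp add: continuous_on_eq_continuous_at)
      then obtain \<delta> where \<delta>: "\<delta> > 0" "\<And>y. dist y x < \<delta> \<Longrightarrow> dist (f y) (f x) < 1"
        unfolding continuous_at_eps_delta by (metis zero_less_one)
      have "norm v \<le> 4 / \<delta>" if v: "v \<in> C 0" for v
      proof (cases "v = 0")
        case False
        \<comment> \<open>a step of length \<open>\<delta> / 2\<close> in the direction of steepest ascent of the minorant\<close>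
        define y where "y = x + (\<delta> / (2 * norm v)) *\<^sub>R v"
        have "dist y x < \<delta>" using \<delta> False by (simp add: y_def dist_norm)
        then have "f y < f x + 1" using \<delta>(2)[of y] by (simp add: dist_real_def)
        moreover have "f x - 1 + inner (y - x) v \<le> f y" using v by (simp add: C_def)
        moreover have "inner (y - x) v = \<delta> * norm v / 2"
          using False by (simp add: y_def power2_norm_eq_inner[symmetric] power2_eq_square)
        ultimately have "\<delta> * norm v / 2 < 2" by linarith
        then show ?thesis using \<delta>(1) by (simp add: field_simps)
      qed (use \<delta> in simp)
      then show ?thesis by (auto simp: bounded_iff)
    qed
  qed
  then obtain v where v: "\<And>n. v \<in> C n" by blast
  have "f x + inner (y - x) v \<le> f y" for y
  proof -
    have "(\<lambda>n. f x - 1 / real (Suc n) + inner (y - x) v) \<longlonglongrightarrow> f x - 0 + inner (y - x) v"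
      by (intro tendsto_intros LIMSEQ_Suc[OF lim_1_over_n])
    then have "f x - 0 + inner (y - x) v \<le> f y"
      by (rule LIMSEQ_le_const2) (use v in \<open>auto simp: C_def\<close>)
    then show ?thesis by simp
  qed
  then show ?thesis by (auto simp: subdifferential_def)
qed

text \<open>A single subgradient at \<open>x\<close> supports \<open>f\<close> globally. It also shows that \<open>c\<close> is nonnegative,
  because the bound speaks about some existing vector.\<close>

lemma subgradient_bound_decrease:
  fixes f :: "'a::{real_inner, complete_space} \<Rightarrow> real"
  assumes "continuous_on UNIV f" and "convex_on UNIV f"
    and "\<And>v. v \<in> subdifferential f x \<Longrightarrow> norm v \<le> c"
  shows "0 \<le> c" and "f x - f u \<le> c * norm (x - u)"
proof -
  obtain v where v: "v \<in> subdifferential f x"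
    using subdifferential_nonempty[OF assms(1,2)] by blast
  have "norm v \<le> c" by (rule assms(3)[OF v])
  then show "0 \<le> c" by (rule order_trans[OF norm_ge_zero])
  have "f x + inner (u - x) v \<le> f u" using v by (auto simp: subdifferential_def)
  then have "f x - f u \<le> inner (x - u) v" by (simp add: inner_diff_left)
  also have "\<dots> \<le> norm (x - u) * norm v" by (rule norm_cauchy_schwarz)
  also have "\<dots> \<le> c * norm (x - u)"
    using \<open>norm v \<le> c\<close> by (simp add: mult.commute mult_right_mono)
  finally show "f x - f u \<le> c * norm (x - u)" .
qed

section \<open>One step of the method\<close>

text \<open>The relaxed point minus \<open>y\<close> is an affine combination of \<open>z - y\<close> and \<open>Q z - y\<close>. The
  identity for its squared norm contributes \<open>\<alpha> * (1 - \<alpha>)\<close> to the factor of the squared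
  displacement, and quasi-firmness of \<open>Q\<close> contributes \<open>1 - \<alpha>\<close>.\<close>

lemma relaxation_quasi_firm:
  fixes Q :: "'a::real_inner \<Rightarrow> 'a"
  assumes "quasi_firmly_nonexpansive Q" and "y \<in> Fix Q" and "\<alpha> \<le> 1"
  shows "(norm (relaxation \<alpha> Q z - y))\<^sup>2
    \<le> (norm (z - y))\<^sup>2 - (1 - \<alpha>) * (1 + \<alpha>) * (norm (z - Q z))\<^sup>2"
proof -
  have "(norm (\<alpha> *\<^sub>R a + (1 - \<alpha>) *\<^sub>R b))\<^sup>2
      = \<alpha> * (norm a)\<^sup>2 + (1 - \<alpha>) * (norm b)\<^sup>2 - \<alpha> * (1 - \<alpha>) * (norm (a - b))\<^sup>2"
    for a b :: 'a
    by (simp add: power2_norm_eq_inner inner_commute algebra_simps)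
  from this[of "z - y" "Q z - y"] have "(norm (relaxation \<alpha> Q z - y))\<^sup>2
      = \<alpha> * (norm (z - y))\<^sup>2 + (1 - \<alpha>) * (norm (Q z - y))\<^sup>2 - \<alpha> * (1 - \<alpha>) * (norm (z - Q z))\<^sup>2"
    by (simp add: relaxation_def algebra_simps)
  moreover have "(norm (Q z - y))\<^sup>2 \<le> (norm (z - y))\<^sup>2 - (norm (z - Q z))\<^sup>2"
    using assms(1,2) by (simp add: quasi_firmly_nonexpansive_def le_diff_eq)
  then have "(1 - \<alpha>) * (norm (Q z - y))\<^sup>2 \<le> (1 - \<alpha>) * ((norm (z - y))\<^sup>2 - (norm (z - Q z))\<^sup>2)"
    using assms(3) by (intro mult_left_mono) auto
  ultimately show ?thesis by (simp add: algebra_simps)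
qed

lemma norm_relaxation_displacement:
  assumes "\<alpha> \<le> 1"
  shows "norm (z - relaxation \<alpha> Q z) = (1 - \<alpha>) * norm (z - Q z)"
proof -
  have "z - relaxation \<alpha> Q z = (1 - \<alpha>) *\<^sub>R (z - Q z)"
    by (simp add: relaxation_def algebra_simps)
  then show ?thesis using assms by simp
qed

lemma subgradient_step_distance:
  assumes "quasi_firmly_nonexpansive Q" and "y \<in> Fix Q" and "\<alpha> \<le> 1"
    and "(norm g)\<^sup>2 \<le> N"
  shows "(norm (relaxation \<alpha> Q z - lam *\<^sub>R g - y))\<^sup>2
    \<le> (norm (z - y))\<^sup>2 - (1 - \<alpha>) * (1 + \<alpha>) * (norm (z - Q z))\<^sup>2
      + 2 * lam * inner (y - relaxation \<alpha> Q z) g + lam\<^sup>2 * N"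
proof -
  let ?u = "relaxation \<alpha> Q z"
  have "(norm (?u - lam *\<^sub>R g - y))\<^sup>2
      = (norm (?u - y))\<^sup>2 + 2 * lam * inner (y - ?u) g + lam\<^sup>2 * (norm g)\<^sup>2"
  proof -
    have "(norm (a - lam *\<^sub>R g))\<^sup>2 = (norm a)\<^sup>2 + 2 * lam * inner (- a) g + lam\<^sup>2 * (norm g)\<^sup>2" for a
      by (simp add: power2_norm_eq_inner inner_commute algebra_simps) (simp add: power2_eq_square)
    from this[of "?u - y"] show ?thesis by (simp add: algebra_simps)
  qed
  moreover have "lam\<^sup>2 * (norm g)\<^sup>2 \<le> lam\<^sup>2 * N" using assms(4) by (intro mult_left_mono) auto
  ultimately show ?thesis using relaxation_quasi_firm[OF assms(1-3), of z] by linarith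
qed

lemma subgradient_step_objective:
  assumes "quasi_firmly_nonexpansive Q" and "y \<in> Fix Q" and "-1 \<le> \<alpha>" "\<alpha> \<le> 1" and "0 \<le> lam"
    and "(norm g)\<^sup>2 \<le> N" and "g \<in> subdifferential f (relaxation \<alpha> Q z)"
  shows "(norm (relaxation \<alpha> Q z - lam *\<^sub>R g - y))\<^sup>2
    \<le> (norm (z - y))\<^sup>2 + 2 * lam * (f y - f (relaxation \<alpha> Q z)) + lam\<^sup>2 * N"
proof -
  let ?u = "relaxation \<alpha> Q z"
  have "inner (y - ?u) g \<le> f y - f ?u"
    using assms(7) by (simp add: subdifferential_def algebra_simps)
  then have "2 * lam * inner (y - ?u) g \<le> 2 * lam * (f y - f ?u)"
    using assms(5) by (intro mult_left_mono) auto
  moreover have "0 \<le> (1 - \<alpha>) * (1 + \<alpha>) * (norm (z - Q z))\<^sup>2"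
    using assms(3,4) by simp
  ultimately show ?thesis
    using subgradient_step_distance[OF assms(1,2,4,6), of z lam] by linarith
qed

text \<open>The inner product with \<open>g\<close> is to be taken at \<open>z\<close> instead of the relaxed point. The difference
  is at most \<open>w * norm g\<close>, where \<open>w\<close> is the length of the relaxed move. Young's inequality splits
  it into \<open>w\<^sup>2\<close>, which reduces the factor \<open>(1 - \<alpha>) * (1 + \<alpha>)\<close> of the squared displacement to
  \<open>2 * \<alpha> * (1 - \<alpha>)\<close>, and a second copy of \<open>lam\<^sup>2 * N\<close>.\<close>

lemma subgradient_step_displacement:
  assumes "quasi_firmly_nonexpansive Q" and "y \<in> Fix Q" and "\<alpha> \<le> 1" and "0 \<le> lam"
    and "(norm g)\<^sup>2 \<le> N"
  shows "(norm (relaxation \<alpha> Q z - lam *\<^sub>R g - y))\<^sup>2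
    \<le> (norm (z - y))\<^sup>2 - 2 * \<alpha> * (1 - \<alpha>) * (norm (z - Q z))\<^sup>2
      + 2 * lam * (inner (y - z) g + N * lam)"
proof -
  let ?u = "relaxation \<alpha> Q z"
  define w where "w = (1 - \<alpha>) * norm (z - Q z)"
  have w: "norm (z - ?u) = w"
    using assms(3) by (simp add: w_def norm_relaxation_displacement)
  have "2 * lam * inner (z - ?u) g \<le> 2 * lam * (w * norm g)"
    using assms(4) norm_cauchy_schwarz[of "z - ?u" g] by (intro mult_left_mono) (auto simp: w)
  also have "\<dots> \<le> w\<^sup>2 + (lam * norm g)\<^sup>2"
    using sum_squares_bound[of w "lam * norm g"] by (simp add: algebra_simps)
  also have "\<dots> \<le> w\<^sup>2 + lam\<^sup>2 * N"
    using assms(5) by (simp add: power_mult_distrib mult_left_mono)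
  finally have "2 * lam * inner (z - ?u) g \<le> w\<^sup>2 + lam\<^sup>2 * N" .
  moreover have "inner (y - ?u) g = inner (y - z) g + inner (z - ?u) g"
    by (simp add: inner_diff_left)
  moreover have "(1 - \<alpha>) * (1 + \<alpha>) * (norm (z - Q z))\<^sup>2
      = 2 * \<alpha> * (1 - \<alpha>) * (norm (z - Q z))\<^sup>2 + w\<^sup>2"
    by (simp add: w_def power_mult_distrib) (simp add: algebra_simps power2_eq_square)
  ultimately show ?thesis
    using subgradient_step_distance[OF assms(1-3,5), of z lam]
    by (simp add: algebra_simps power2_eq_square)
qed

section \<open>One round of the method\<close>

lemma sum_telescope_from_1:
  fixes r :: "nat \<Rightarrow> real"
  shows "(\<Sum>i\<in>{1..I}. r (i - 1) - r i) = r 0 - r I"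
  by (induction I) auto

context
  fixes I :: nat
    and f :: "nat \<Rightarrow> 'a::{real_inner, complete_space} \<Rightarrow> real"
    and Q :: "nat \<Rightarrow> 'a \<Rightarrow> 'a"
    and \<alpha> :: "nat \<Rightarrow> real"
    and lam :: real
    and x :: "nat \<Rightarrow> 'a"
    and xs g :: "nat \<Rightarrow> nat \<Rightarrow> 'a"
    and N1 :: real
  assumes \<alpha>: "\<And>i. i \<in> {1..I} \<Longrightarrow> 0 < \<alpha> i \<and> \<alpha> i < 1"
    and quasi_firm: "\<And>i. i \<in> {1..I} \<Longrightarrow> quasi_firmly_nonexpansive (Q i)"
    and lam_pos: "lam > 0"
    and iteration: "incremental_subgradient I f Q \<alpha> (\<lambda>n. lam) x xs g"
    and g_bound: "\<And>n i. i \<in> {1..I} \<Longrightarrow> (norm (g n i))\<^sup>2 \<le> N1"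
begin

abbreviation relaxed :: "nat \<Rightarrow> nat \<Rightarrow> 'a" where
  "relaxed n i \<equiv> relaxation (\<alpha> i) (Q i) (xs n (i - 1))"

abbreviation displacement :: "nat \<Rightarrow> nat \<Rightarrow> real" where
  "displacement n i \<equiv> norm (xs n (i - 1) - Q i (xs n (i - 1)))"

lemma start_of_round: "xs n 0 = x n"
  and end_of_round: "xs n I = x (Suc n)"
  and inner_step: "i \<in> {1..I} \<Longrightarrow> xs n i = relaxed n i - lam *\<^sub>R g n i"
  and g_subgradient: "i \<in> {1..I} \<Longrightarrow> g n i \<in> subdifferential (f i) (relaxed n i)"
  using iteration by (auto simp: incremental_subgradient_def)

text \<open>In the sum of the estimates for all users, the distances between consecutive inner iterates
  and \<open>y\<close> telescope.\<close>

lemma round_displacement: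
  assumes "y \<in> common_fix I Q"
  shows "(\<Sum>i\<in>{1..I}. 2 * \<alpha> i * (1 - \<alpha> i) * (displacement n i)\<^sup>2)
    \<le> (norm (x n - y))\<^sup>2 - (norm (x (Suc n) - y))\<^sup>2
      + 2 * lam * (real I * N1 * lam + \<bar>\<Sum>i\<in>{1..I}. inner (y - xs n (i - 1)) (g n i)\<bar>)"
proof -
  let ?r = "\<lambda>i. (norm (xs n i - y))\<^sup>2" and ?e = "\<lambda>i. inner (y - xs n (i - 1)) (g n i)"
  have "2 * \<alpha> i * (1 - \<alpha> i) * (displacement n i)\<^sup>2
      \<le> (?r (i - 1) - ?r i) + 2 * lam * (?e i + N1 * lam)" if i: "i \<in> {1..I}" for i
  proof -
    have "y \<in> Fix (Q i)" using assms i by (auto simp: common_fix_def)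
    from subgradient_step_displacement[OF quasi_firm[OF i] this _ _ g_bound[OF i, of n],
        of "\<alpha> i" lam "xs n (i - 1)"]
    have "?r i \<le> ?r (i - 1) - 2 * \<alpha> i * (1 - \<alpha> i) * (displacement n i)\<^sup>2
        + 2 * lam * (?e i + N1 * lam)"
      using \<alpha>[OF i] lam_pos by (simp only: inner_step[OF i, of n]) simp
    then show ?thesis by linarith
  qed
  then have "(\<Sum>i\<in>{1..I}. 2 * \<alpha> i * (1 - \<alpha> i) * (displacement n i)\<^sup>2)
      \<le> (\<Sum>i\<in>{1..I}. (?r (i - 1) - ?r i) + 2 * lam * (?e i + N1 * lam))"
    by (rule sum_mono)
  also have "\<dots> = (?r 0 - ?r I) + 2 * lam * (real I * N1 * lam + (\<Sum>i\<in>{1..I}. ?e i))"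
    by (simp only: sum.distrib sum_telescope_from_1[of ?r] sum_distrib_left[symmetric])
      (simp add: algebra_simps)
  also have "\<dots> \<le> (?r 0 - ?r I) + 2 * lam * (real I * N1 * lam + \<bar>\<Sum>i\<in>{1..I}. ?e i\<bar>)"
    using lam_pos by (intro add_left_mono mult_left_mono) auto
  finally show ?thesis by (simp add: start_of_round end_of_round)
qed

lemma displacement_mean_le:
  assumes y: "y \<in> common_fix I Q"
    and M: "\<And>n. real I * N1 * lam + \<bar>\<Sum>i\<in>{1..I}. inner (y - xs n (i - 1)) (g n i)\<bar> \<le> M"
    and i: "i \<in> {1..I}"
  shows "mean_le (\<lambda>n. (displacement n i)\<^sup>2) (M * lam / (\<alpha> i * (1 - \<alpha> i)))"
proof -
  let ?k = "2 * \<alpha> i * (1 - \<alpha> i)" and ?r = "\<lambda>n. (norm (x n - y))\<^sup>2"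
  have k: "?k > 0" using \<alpha>[OF i] by simp
  have le: "(displacement n i)\<^sup>2 \<le> (1 / ?k) * ((?r n - ?r (Suc n)) + 2 * lam * M)" for n
  proof -
    have "?k * (displacement n i)\<^sup>2 \<le> (\<Sum>i\<in>{1..I}. 2 * \<alpha> i * (1 - \<alpha> i) * (displacement n i)\<^sup>2)"
      using i \<alpha> by (intro member_le_sum) (auto simp: less_imp_le)
    also note round_displacement[OF y]
    also have "?r n - ?r (Suc n)
        + 2 * lam * (real I * N1 * lam + \<bar>\<Sum>i\<in>{1..I}. inner (y - xs n (i - 1)) (g n i)\<bar>)
        \<le> (?r n - ?r (Suc n)) + 2 * lam * M"
      using lam_pos M[of n] by (intro add_left_mono mult_left_mono) auto
    finally show ?thesis using k by (simp add: field_simps)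
  qed
  have "mean_le (\<lambda>n. (1 / ?k) * ((?r n - ?r (Suc n)) + 2 * lam * M)) ((1 / ?k) * (0 + 2 * lam * M))"
    using k by (intro mean_le_cmult mean_le_add mean_le_telescope mean_le_const) auto
  then show ?thesis
    by (rule mean_le_mono) (use le \<alpha>[OF i] in \<open>auto simp: field_simps\<close>)
qed

text \<open>User \<open>j\<close> moves the iterate by the relaxed displacement and then by a subgradient step of
  length at most \<open>lam * sqrt N1\<close>.\<close>

lemma drift_within_round:
  assumes "i \<le> I"
  shows "norm (x n - xs n i) \<le> (\<Sum>j\<in>{1..i}. (1 - \<alpha> j) * displacement n j) + real i * (lam * sqrt N1)"
  using assms
proof (induction i)
  case 0
  show ?case by (simp add: start_of_round)
next
  case (Suc i)
  then have i: "Suc i \<in> {1..I}" by simp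
  have "norm (g n (Suc i)) \<le> sqrt N1" using g_bound[OF i] by (simp add: real_le_rsqrt)
  then have "norm (lam *\<^sub>R g n (Suc i)) \<le> lam * sqrt N1" using lam_pos by simp
  moreover have "norm (xs n i - relaxed n (Suc i)) = (1 - \<alpha> (Suc i)) * displacement n (Suc i)"
    using \<alpha>[OF i] by (simp add: norm_relaxation_displacement)
  moreover have "x n - xs n (Suc i)
      = (x n - xs n i) + ((xs n i - relaxed n (Suc i)) + lam *\<^sub>R g n (Suc i))"
    by (simp add: inner_step[OF i])
  then have "norm (x n - xs n (Suc i))
      \<le> norm (x n - xs n i) + (norm (xs n i - relaxed n (Suc i)) + norm (lam *\<^sub>R g n (Suc i)))"
    by (simp only:) (intro order_trans[OF norm_triangle_ineq] add_left_mono norm_triangle_ineq)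
  ultimately show ?case using Suc by (simp add: algebra_simps)
qed

text \<open>The step of user \<open>i\<close> bounds \<open>f i\<close> at the relaxed point; a subgradient at \<open>x n\<close> transfers
  the bound to \<open>x n\<close> at the cost of \<open>N2\<close> times the drift. The drift up to the relaxed point
  of user \<open>i\<close> consists of \<open>i\<close> relaxed displacements, but only \<open>i - 1\<close> subgradient steps.\<close>

lemma round_objective:
  assumes y: "y \<in> common_fix I Q"
    and cont: "\<And>i. i \<in> {1..I} \<Longrightarrow> continuous_on UNIV (f i)"
    and conv: "\<And>i. i \<in> {1..I} \<Longrightarrow> convex_on UNIV (f i)"
    and N2: "\<And>i v. i \<in> {1..I} \<Longrightarrow> v \<in> subdifferential (f i) (x n) \<Longrightarrow> norm v \<le> N2"
  shows "total_objective I f (x n)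
    \<le> total_objective I f y + real I * N1 * lam / 2
      + N2 * (\<Sum>i\<in>{1..I}. (\<Sum>j\<in>{1..i}. (1 - \<alpha> j) * displacement n j) + real (i - 1) * (lam * sqrt N1))
      + (1 / (2 * lam)) * ((norm (x n - y))\<^sup>2 - (norm (x (Suc n) - y))\<^sup>2)"
proof -
  let ?r = "\<lambda>i. (norm (xs n i - y))\<^sup>2"
  let ?D = "\<lambda>i. (\<Sum>j\<in>{1..i}. (1 - \<alpha> j) * displacement n j) + real (i - 1) * (lam * sqrt N1)"
  have "f i (x n) \<le> f i y + N1 * lam / 2 + N2 * ?D i + (1 / (2 * lam)) * (?r (i - 1) - ?r i)"
    if i: "i \<in> {1..I}" for i
  proof -
    have "y \<in> Fix (Q i)" using y i by (auto simp: common_fix_def)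
    from subgradient_step_objective[OF quasi_firm[OF i] this _ _ _ g_bound[OF i, of n]
        g_subgradient[OF i, of n]]
    have "?r i \<le> ?r (i - 1) + 2 * lam * (f i y - f i (relaxed n i)) + lam\<^sup>2 * N1"
      using \<alpha>[OF i] lam_pos by (simp only: inner_step[OF i, of n]) simp
    then have step: "f i (relaxed n i) \<le> f i y + N1 * lam / 2 + (1 / (2 * lam)) * (?r (i - 1) - ?r i)"
      using lam_pos by (simp add: field_simps power2_eq_square)
    have "norm (x n - relaxed n i) \<le> norm (x n - xs n (i - 1)) + norm (xs n (i - 1) - relaxed n i)"
      using norm_triangle_ineq[of "x n - xs n (i - 1)" "xs n (i - 1) - relaxed n i"] by simp
    also have "norm (xs n (i - 1) - relaxed n i) = (1 - \<alpha> i) * displacement n i"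
      using \<alpha>[OF i] by (simp add: norm_relaxation_displacement)
    also have "norm (x n - xs n (i - 1)) + (1 - \<alpha> i) * displacement n i \<le> ?D i"
    proof -
      obtain k where k: "i = Suc k" using i by (cases i) auto
      have "k \<le> I" using i k by simp
      from drift_within_round[OF this, of n] show ?thesis by (simp add: k)
    qed
    finally have drift: "norm (x n - relaxed n i) \<le> ?D i" .
    have "f i (x n) - f i (relaxed n i) \<le> N2 * norm (x n - relaxed n i)"
      by (rule subgradient_bound_decrease(2)[OF cont[OF i] conv[OF i] N2[OF i]])
    also have "\<dots> \<le> N2 * ?D i"
      by (rule mult_left_mono[OF drift subgradient_bound_decrease(1)[OF cont[OF i] conv[OF i] N2[OF i]]])
    finally show ?thesis using step by linarith
  qed
  then have "total_objective I f (x n)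
      \<le> (\<Sum>i\<in>{1..I}. f i y + N1 * lam / 2 + N2 * ?D i + (1 / (2 * lam)) * (?r (i - 1) - ?r i))"
    unfolding total_objective_def by (rule sum_mono)
  also have "\<dots> = total_objective I f y + real I * N1 * lam / 2 + N2 * (\<Sum>i\<in>{1..I}. ?D i)
      + (1 / (2 * lam)) * (?r 0 - ?r I)"
    unfolding total_objective_def
    by (simp only: sum.distrib sum_distrib_left[symmetric] sum_telescope_from_1[of ?r]) simp
  finally show ?thesis by (simp only: start_of_round end_of_round)
qed

lemma objective_mean_le:
  assumes y: "y \<in> common_fix I Q" and "0 \<le> N2"
    and cont: "\<And>i. i \<in> {1..I} \<Longrightarrow> continuous_on UNIV (f i)"
    and conv: "\<And>i. i \<in> {1..I} \<Longrightarrow> convex_on UNIV (f i)"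
    and N2: "\<And>n i v. i \<in> {1..I} \<Longrightarrow> v \<in> subdifferential (f i) (x n) \<Longrightarrow> norm v \<le> N2"
    and s: "\<And>j. j \<in> {1..I} \<Longrightarrow> mean_le (\<lambda>n. (1 - \<alpha> j) * displacement n j) (s j)"
  shows "mean_le (\<lambda>n. total_objective I f (x n))
    (total_objective I f y + real I * N1 * lam / 2
      + N2 * (\<Sum>i\<in>{1..I}. (\<Sum>j\<in>{1..i}. s j) + real (i - 1) * (lam * sqrt N1)))"
proof -
  let ?r = "\<lambda>n. (norm (x n - y))\<^sup>2"
  let ?D = "\<lambda>n i. (\<Sum>j\<in>{1..i}. (1 - \<alpha> j) * displacement n j) + real (i - 1) * (lam * sqrt N1)"
  let ?S = "\<lambda>i. (\<Sum>j\<in>{1..i}. s j) + real (i - 1) * (lam * sqrt N1)"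
  let ?c = "total_objective I f y + real I * N1 * lam / 2"
  have "mean_le (\<lambda>n. ?D n i) (?S i)" if "i \<in> {1..I}" for i
    using that by (intro mean_le_add[OF mean_le_sum mean_le_const] s) auto
  then have "mean_le (\<lambda>n. \<Sum>i\<in>{1..I}. ?D n i) (\<Sum>i\<in>{1..I}. ?S i)"
    by (intro mean_le_sum) auto
  then have "mean_le (\<lambda>n. ?c + N2 * (\<Sum>i\<in>{1..I}. ?D n i)) (?c + N2 * (\<Sum>i\<in>{1..I}. ?S i))"
    by (intro mean_le_add[OF mean_le_const] mean_le_cmult \<open>0 \<le> N2\<close>)
  moreover have "mean_le (\<lambda>n. (1 / (2 * lam)) * (?r n - ?r (Suc n))) ((1 / (2 * lam)) * 0)"
    using lam_pos by (intro mean_le_cmult mean_le_telescope) auto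
  ultimately have "mean_le
      (\<lambda>n. ?c + N2 * (\<Sum>i\<in>{1..I}. ?D n i) + (1 / (2 * lam)) * (?r n - ?r (Suc n)))
      (?c + N2 * (\<Sum>i\<in>{1..I}. ?S i) + (1 / (2 * lam)) * 0)"
    by (rule mean_le_add)
  then show ?thesis
  proof (rule mean_le_mono)
    show "total_objective I f (x n)
        \<le> ?c + N2 * (\<Sum>i\<in>{1..I}. ?D n i) + (1 / (2 * lam)) * (?r n - ?r (Suc n))" for n
      by (rule round_objective[OF y cont conv N2])
  qed simp
qed

end

section \<open>Limit inferior bounds\<close>

lemma sum_of_predecessors_le: "(\<Sum>i\<in>{1..I}. real (i - 1)) \<le> real I * real I / 2"
  by (induction I) (auto simp: field_simps)

lemma norm_le_of_SUP_le:
  assumes "(SUP u\<in>A. ereal (norm u)) \<le> ereal c" and "u \<in> A"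
  shows "norm u \<le> c"
  using assms by (simp add: SUP_le_iff)

theorem theorem4p1:
  fixes I :: nat
    and f :: "nat \<Rightarrow> 'a::{real_inner, complete_space} \<Rightarrow> real"
    and Q :: "nat \<Rightarrow> 'a \<Rightarrow> 'a"
    and \<alpha> :: "nat \<Rightarrow> real"
    and lam :: real
    and x :: "nat \<Rightarrow> 'a"
    and xs g :: "nat \<Rightarrow> nat \<Rightarrow> 'a"
    and N1i N2i :: "nat \<Rightarrow> real"
    and N1 N2 :: real
    and xhat :: 'a
    and Nlam :: ereal
  assumes "I \<ge> 1"
    and "\<And>i. i \<in> {1..I} \<Longrightarrow> 0 < \<alpha> i \<and> \<alpha> i < 1"
    and "\<And>i. i \<in> {1..I} \<Longrightarrow> quasi_firmly_nonexpansive (Q i)"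
    and "\<And>i. i \<in> {1..I} \<Longrightarrow> continuous_on UNIV (f i)"
    and "\<And>i. i \<in> {1..I} \<Longrightarrow> convex_on UNIV (f i)"
    and "solution_set I f Q \<noteq> {}"
    and "lam > 0"
    and "incremental_subgradient I f Q \<alpha> (\<lambda>n. lam) x xs g"
    and "\<And>i. i \<in> {1..I} \<Longrightarrow>
           (SUP u \<in> (\<Union>n. subdifferential (f i) (relaxation (\<alpha> i) (Q i) (xs n (i - 1)))).
              ereal (norm u)) \<le> ereal (N1i i)"
    and "\<And>i. i \<in> {1..I} \<Longrightarrow>
           (SUP u \<in> (\<Union>n. subdifferential (f i) (x n)). ereal (norm u)) \<le> ereal (N2i i)"
    and "N1 = Max ((\<lambda>i. (N1i i)\<^sup>2) ` {1..I})"
    and "N2 = Max (N2i ` {1..I})"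
    and "xhat \<in> common_fix I Q"
    and "Nlam = (SUP n. ereal (real I * N1 * lam
                   + \<bar>\<Sum>i\<in>{1..I}. inner (xhat - xs n (i - 1)) (g n i)\<bar>))"
  shows "(\<forall>i\<in>{1..I}.
            liminf (\<lambda>n. ereal ((norm (xs n (i - 1) - Q i (xs n (i - 1))))\<^sup>2))
              \<le> (if Nlam = \<infinity> then \<infinity>
                 else ereal (real_of_ereal Nlam * lam / (\<alpha> i * (1 - \<alpha> i))))) \<and>
         liminf (\<lambda>n. ereal (total_objective I f (x n)))
           \<le> (if Nlam = \<infinity> then \<infinity>
              else optimal_value I f Q
                + ereal (real I * (real I * sqrt N1 * N2 / 2 + N1) * lam
                    + N2 * (\<Sum>i\<in>{1..I}. \<Sum>j\<in>{1..i-1}.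
                              sqrt ((1 - \<alpha> j) * real_of_ereal Nlam * lam / \<alpha> j))
                    + (sqrt N1 + N2) * (\<Sum>i\<in>{1..I}.
                              sqrt ((1 - \<alpha> i) * real_of_ereal Nlam * lam / \<alpha> i))))"
proof (cases "Nlam = \<infinity>")
  case False
  note I = assms(1) and \<alpha> = assms(2) and cont = assms(4) and conv = assms(5) and lam_pos = assms(7) and iteration = assms(8)
  have g_norm: "norm (g n i) \<le> N1i i" if "i \<in> {1..I}" for n i
  proof (rule norm_le_of_SUP_le[OF assms(9)[OF that]])
    show "g n i \<in> (\<Union>n. subdifferential (f i) (relaxation (\<alpha> i) (Q i) (xs n (i - 1))))"
      using iteration that unfolding incremental_subgradient_def by blast
  qed
  have g_bound: "(norm (g n i))\<^sup>2 \<le> N1" if i: "i \<in> {1..I}" for n i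
  proof -
    have "(norm (g n i))\<^sup>2 \<le> (N1i i)\<^sup>2" using g_norm[OF i] by (intro power_mono) auto
    also have "\<dots> \<le> N1" unfolding assms(11) using i by (intro Max_ge) auto
    finally show ?thesis .
  qed
  note setting = \<alpha> assms(3) lam_pos iteration g_bound
  have N1: "0 \<le> N1"
    using order_trans[OF zero_le_power2 g_bound[of 1 0]] I by simp
  have N2: "norm v \<le> N2" if "i \<in> {1..I}" and "v \<in> subdifferential (f i) (x n)" for n i v
  proof -
    have "norm v \<le> N2i i"
      by (rule norm_le_of_SUP_le[OF assms(10)[OF that(1)]]) (use that(2) in blast)
    also have "\<dots> \<le> N2" unfolding assms(12) using that(1) by (intro Max_ge) auto
    finally show ?thesis .
  qed
  \<comment> \<open>This rests on the existence of a subgradient: over an empty subdifferential the supremum is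
    \<open>-\<infinity>\<close> and would allow a negative bound.\<close>
  have N2_nonneg: "0 \<le> N2"
    using subgradient_bound_decrease(1)[OF cont[of 1] conv[of 1] N2[of 1 _ 0]] I by simp

  let ?e = "\<lambda>n. real I * N1 * lam + \<bar>\<Sum>i\<in>{1..I}. inner (xhat - xs n (i - 1)) (g n i)\<bar>"
  define M where "M = real_of_ereal Nlam"
  have le_Nlam: "ereal (?e n) \<le> Nlam" for n
    unfolding assms(14) by (rule SUP_upper) simp
  from this[of 0] have "Nlam \<noteq> -\<infinity>" by auto
  then have Nlam: "Nlam = ereal M" using False by (cases Nlam) (auto simp: M_def)
  have M: "?e n \<le> M" for n using le_Nlam[of n] by (simp add: Nlam)
  have "0 \<le> ?e 0" using N1 lam_pos by simp
  then have M_nonneg: "0 \<le> M" using M[of 0] by linarith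
  let ?d = "\<lambda>n i. norm (xs n (i - 1) - Q i (xs n (i - 1)))"
  have disp: "mean_le (\<lambda>n. (?d n i)\<^sup>2) (M * lam / (\<alpha> i * (1 - \<alpha> i)))"
    if "i \<in> {1..I}" for i
    using displacement_mean_le[OF setting assms(13) M that] .

  \<comment> \<open>\<open>(1 - \<alpha> i)\<^sup>2\<close> times the mean bound on the squared displacement is exactly \<open>(s i)\<^sup>2\<close>.\<close>
  define s where "s i = sqrt ((1 - \<alpha> i) * M * lam / \<alpha> i)" for i
  have s_nonneg: "0 \<le> s i" if "i \<in> {1..I}" for i
    using \<alpha>[OF that] M_nonneg lam_pos by (simp add: s_def)
  have s: "mean_le (\<lambda>n. (1 - \<alpha> i) * ?d n i) (s i)" if i: "i \<in> {1..I}" for i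
  proof (rule mean_le_of_square[OF _ s_nonneg[OF i]])
    have "mean_le (\<lambda>n. (1 - \<alpha> i)\<^sup>2 * (?d n i)\<^sup>2)
        ((1 - \<alpha> i)\<^sup>2 * (M * lam / (\<alpha> i * (1 - \<alpha> i))))"
      by (rule mean_le_cmult[OF disp[OF i]]) simp
    moreover have "(1 - \<alpha> i)\<^sup>2 * (M * lam / (\<alpha> i * (1 - \<alpha> i))) = (s i)\<^sup>2"
    proof -
      have "(s i)\<^sup>2 = (1 - \<alpha> i) * M * lam / \<alpha> i"
        using \<alpha>[OF i] M_nonneg lam_pos by (simp add: s_def)
      moreover have "b\<^sup>2 * (c / (a * b)) = b * c / a" if "b \<noteq> 0" for a b c :: real
        using that by (simp add: power2_eq_square)
      ultimately show ?thesis using \<alpha>[OF i] by (simp add: mult.assoc)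
    qed
    ultimately show "mean_le (\<lambda>n. ((1 - \<alpha> i) * ?d n i)\<^sup>2) ((s i)\<^sup>2)"
      by (simp add: power_mult_distrib)
  qed

  obtain y where y: "y \<in> common_fix I Q" "optimal_value I f Q = ereal (total_objective I f y)"
    using assms(6) by (auto simp: solution_set_def)
  define C where "C = real I * (real I * sqrt N1 * N2 / 2 + N1) * lam
      + N2 * (\<Sum>i\<in>{1..I}. \<Sum>j\<in>{1..i - 1}. s j) + (sqrt N1 + N2) * (\<Sum>i\<in>{1..I}. s i)"
  have "real I * N1 * lam / 2
      + N2 * (\<Sum>i\<in>{1..I}. (\<Sum>j\<in>{1..i}. s j) + real (i - 1) * (lam * sqrt N1)) \<le> C"
  proof -
    \<comment> \<open>The term \<open>j = i\<close> of each inner sum belongs to the single sum over all users; the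
      subgradient steps add up to at most \<open>I\<^sup>2 / 2\<close> step lengths.\<close>
    have "(\<Sum>j\<in>{1..i}. s j) = (\<Sum>j\<in>{1..i - 1}. s j) + s i" if "i \<in> {1..I}" for i
      using that by (cases i) auto
    then have "(\<Sum>i\<in>{1..I}. (\<Sum>j\<in>{1..i}. s j) + real (i - 1) * (lam * sqrt N1))
        = (\<Sum>i\<in>{1..I}. (\<Sum>j\<in>{1..i - 1}. s j) + s i + real (i - 1) * (lam * sqrt N1))"
      by (intro sum.cong) auto
    also have "\<dots> = (\<Sum>i\<in>{1..I}. \<Sum>j\<in>{1..i - 1}. s j) + (\<Sum>i\<in>{1..I}. s i)
        + (\<Sum>i\<in>{1..I}. real (i - 1)) * (lam * sqrt N1)"
      by (simp only: sum.distrib sum_distrib_right)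
    also have "\<dots> \<le> (\<Sum>i\<in>{1..I}. \<Sum>j\<in>{1..i - 1}. s j) + (\<Sum>i\<in>{1..I}. s i)
        + (real I * real I / 2) * (lam * sqrt N1)"
      using lam_pos N1 by (intro add_left_mono mult_right_mono sum_of_predecessors_le) auto
    finally have "N2 * (\<Sum>i\<in>{1..I}. (\<Sum>j\<in>{1..i}. s j) + real (i - 1) * (lam * sqrt N1))
        \<le> N2 * ((\<Sum>i\<in>{1..I}. \<Sum>j\<in>{1..i - 1}. s j) + (\<Sum>i\<in>{1..I}. s i)
        + (real I * real I / 2) * (lam * sqrt N1))"
      by (rule mult_left_mono[OF _ N2_nonneg])
    moreover have "0 \<le> sqrt N1 * (\<Sum>i\<in>{1..I}. s i)"
      using N1 s_nonneg by (intro mult_nonneg_nonneg sum_nonneg) auto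
    moreover have "0 \<le> real I * N1 * lam" using N1 lam_pos by simp
    ultimately show ?thesis by (simp add: C_def algebra_simps)
  qed
  then have "mean_le (\<lambda>n. total_objective I f (x n)) (total_objective I f y + C)"
    using mean_le_mono[OF objective_mean_le[OF setting y(1) N2_nonneg cont conv N2 s] order_refl] by simp
  from liminf_le_of_mean_le[OF this]
  have "liminf (\<lambda>n. ereal (total_objective I f (x n))) \<le> optimal_value I f Q + ereal C"
    by (simp add: y(2))
  moreover have "liminf (\<lambda>n. ereal ((?d n i)\<^sup>2)) \<le> ereal (M * lam / (\<alpha> i * (1 - \<alpha> i)))"
    if "i \<in> {1..I}" for i
    using liminf_le_of_mean_le[OF disp[OF that]] .
  ultimately show ?thesis using False by (simp add: C_def s_def M_def)
qed simp

end
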